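(* For each integer $k \ge 2$ the number $N_k$ exists; that is, for each integer $k\ge 2$ there is a positive integer $N$ such that for every integer $n \ge N$ there exists a geometric $(n_k)$ configuration.
   Context: A geometric $(n_k)$ configuration is a set of $n$ distinct points and $n$ distinct (straight) lines in the real Euclidean plane such that each of the points lies on exactly $k$ of the lines and each of the lines contains exactly $k$ of the points. For an integer $k\ge 2$, $N_k$ denotes the smallest positive integer such that for every $n\ge N_k$ there exists a geometric $(n_k)$ configuration (if such a number exists). *)

theory Defs
  imports "HOL-Analysis.Analysis"
begin

definition is_line :: "(real ^ 2) set \<Rightarrow> bool" where
  "is_line l \<longleftrightarrow> affine l \<and> aff_dim l = 1"

definition geometric_configuration ::
  "nat \<Rightarrow> nat \<Rightarrow> (real ^ 2) set \<Rightarrow> (real ^ 2) set set \<Rightarrow> bool" where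
  "geometric_configuration n k P L \<longleftrightarrow>
     finite P \<and> card P = n \<and>
     finite L \<and> card L = n \<and> (\<forall>l\<in>L. is_line l) \<and>
     (\<forall>p\<in>P. card {l\<in>L. p \<in> l} = k) \<and>
     (\<forall>l\<in>L. card {p\<in>P. p \<in> l} = k)"

definition config_threshold :: "nat \<Rightarrow> nat \<Rightarrow> bool" where
  "config_threshold k N \<longleftrightarrow>
     N > 0 \<and> (\<forall>n\<ge>N. \<exists>P L. geometric_configuration n k P L)"

(* The number N_k need not exist a priori, so it is given as a relation:
   is_N k N says that N_k exists and is equal to N. *)
definition is_N :: "nat \<Rightarrow> nat \<Rightarrow> bool" where
  "is_N k N \<longleftrightarrow> config_threshold k N \<and> (\<forall>M. config_threshold k M \<longrightarrow> N \<le> M)"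

end

theory Submission
  imports Defs
begin

text \<open>
  Disjoint union makes the set of all \<open>n\<close> for which an \<open>(n\<^sub>k)\<close> configuration exists a
  semigroup under addition: a generic translate of one configuration has no incidence with
  another one. A semigroup that contains \<open>m > 0\<close> and \<open>q m + 1\<close> contains all large
  integers, so two sizes of this shape suffice.

  The first size comes from a generic projection to the plane of the grid \<open>{0, \<dots>, k-1}\<^sup>k\<close>. It is
  built one dimension at a time: \<open>k\<close> translates of a configuration along a generic direction
  are joined by lines in that direction (\<open>slope_config_add_direction\<close>).

  The second size is \<open>(k - 1) m + 1\<close> (\<open>slope_config_switch\<close>). Given an \<open>(m\<^sub>k)\<close> configuration,
  take \<open>k - 1\<close> of its images under affinities that fix a generic axis pointwise and delete the
  images of one point \<open>p\<close>. The images of each of the \<open>k\<close> lines through \<open>p\<close> meet in a single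
  point of the axis; these \<open>k\<close> meeting points replace the images of \<open>p\<close>, and the axis, added as a line,
  supplies the missing incidence at each of them. There remain \<open>(k - 1) (m - 1) + k\<close> points.

  No direction used in the construction is vertical, so a line is given by slope and
  intercept, and every general position requirement excludes finitely many values of a real
  parameter. The number of lines need not be followed: when points and lines have the same
  degree \<open>k\<close>, double counting of incidences gives as many lines as points.
\<close>

section \<open>Configurations of non-vertical lines\<close>

text \<open>A line is a pair of slope and intercept.\<close>

definition incident :: "real \<times> real \<Rightarrow> real \<times> real \<Rightarrow> bool" where
  "incident p l \<longleftrightarrow> snd p = fst l * fst p + snd l"

text \<open>
  The two degrees are kept apart because the grid is built with lines of full size \<open>k\<close> while
  the degree \<open>d\<close> of the points grows from \<open>0\<close> to \<open>k\<close>.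
\<close>

definition slope_config ::
  "nat \<Rightarrow> nat \<Rightarrow> (real \<times> real) set \<Rightarrow> (real \<times> real) set \<Rightarrow> bool" where
  "slope_config d k P L \<longleftrightarrow>
     finite P \<and> finite L \<and>
     (\<forall>p\<in>P. card {l\<in>L. incident p l} = d) \<and>
     (\<forall>l\<in>L. card {p\<in>P. incident p l} = k)"

lemma slope_config_card_lines:
  assumes "slope_config k k P L" "k > 0"
  shows "card L = card P"
proof -
  have "sum (\<lambda>p. card {l\<in>L. incident p l}) P = k * card L"
    using assms by (intro sum_multicount) (auto simp: slope_config_def)
  then have "k * card P = k * card L"
    using assms by (simp add: slope_config_def)
  then show ?thesis using assms(2) by simp
qed

lemma slope_config_image:
  assumes conf: "slope_config d k P L"
    and inj: "inj f" "inj g"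
    and inc: "\<And>p l. incident (f p) (g l) \<longleftrightarrow> incident p l"
  shows "slope_config d k (f ` P) (g ` L)"
proof -
  have "{l \<in> g ` L. incident (f p) l} = g ` {l\<in>L. incident p l}" for p
    using inc by blast
  moreover have "{p \<in> f ` P. incident p (g l)} = f ` {p\<in>P. incident p l}" for l
    using inc by blast
  moreover have "card (f ` X) = card X" "card (g ` X) = card X" for X
    using inj by (meson card_image inj_on_subset subset_UNIV)+
  ultimately show ?thesis
    using conf unfolding slope_config_def by simp
qed

lemma slope_config_union:
  assumes A: "slope_config d k A LA" and B: "slope_config d k B LB"
    and AB: "\<And>p l. p \<in> A \<Longrightarrow> l \<in> LB \<Longrightarrow> \<not> incident p l"
    and BA: "\<And>p l. p \<in> B \<Longrightarrow> l \<in> LA \<Longrightarrow> \<not> incident p l"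
  shows "slope_config d k (A \<union> B) (LA \<union> LB)"
proof -
  have "{l \<in> LA \<union> LB. incident p l} = {l\<in>LA. incident p l}" if "p \<in> A" for p
    using AB that by blast
  moreover have "{l \<in> LA \<union> LB. incident p l} = {l\<in>LB. incident p l}" if "p \<in> B" for p
    using BA that by blast
  moreover have "{p \<in> A \<union> B. incident p l} = {p\<in>A. incident p l}" if "l \<in> LA" for l
    using BA that by blast
  moreover have "{p \<in> A \<union> B. incident p l} = {p\<in>B. incident p l}" if "l \<in> LB" for l
    using AB that by blast
  ultimately show ?thesis
    using A B unfolding slope_config_def by auto
qed

section \<open>Disjoint unions\<close>

text \<open>
  Each pair of a point and a line is incident for one vertical displacement only, so all but
  finitely many vertical translates of the second configuration avoid the first.
\<close>

lemma slope_config_sum: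
  assumes A: "slope_config d k A LA" and B: "slope_config d k B LB"
  shows "\<exists>P L. slope_config d k P L \<and> card P = card A + card B"
proof -
  have fin: "finite A" "finite LA" "finite B" "finite LB"
    using A B by (auto simp: slope_config_def)
  define bad where "bad =
    (\<lambda>(p, l). snd p - fst l * fst p - snd l) ` (A \<times> LB) \<union>
    (\<lambda>(p, l). fst l * fst p + snd l - snd p) ` (B \<times> LA) \<union>
    (\<lambda>(p, q). snd p - snd q) ` (A \<times> B)"
  have "finite bad" using fin by (auto simp: bad_def)
  then obtain s where s: "s \<notin> bad"
    using ex_new_if_finite infinite_UNIV_char_0 by metis
  define T :: "real \<times> real \<Rightarrow> real \<times> real" where "T = (\<lambda>p. (fst p, snd p + s))"
  have injT: "inj T" by (auto simp: T_def inj_def prod_eq_iff)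
  have B': "slope_config d k (T ` B) (T ` LB)"
    by (rule slope_config_image[OF B injT injT]) (auto simp: T_def incident_def)
  have *: "s \<noteq> snd p - fst l * fst p - snd l" if "p \<in> A" "l \<in> LB" for p l
    using s that unfolding bad_def by (auto simp: image_iff)
  have **: "s \<noteq> fst l * fst p + snd l - snd p" if "p \<in> B" "l \<in> LA" for p l
    using s that unfolding bad_def by (auto simp: image_iff)
  have ***: "s \<noteq> snd p - snd q" if "p \<in> A" "q \<in> B" for p q
    using s that unfolding bad_def by (auto simp: image_iff)
  have conf: "slope_config d k (A \<union> T ` B) (LA \<union> T ` LB)"
  proof (rule slope_config_union[OF A B'])
    show "\<not> incident p l" if "p \<in> A" "l \<in> T ` LB" for p l
      using that * by (fastforce simp: T_def incident_def)
    show "\<not> incident p l" if "p \<in> T ` B" "l \<in> LA" for p l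
      using that ** by (fastforce simp: T_def incident_def)
  qed
  have "A \<inter> T ` B = {}"
    using *** by (fastforce simp: T_def)
  then have "card (A \<union> T ` B) = card A + card B"
    using fin card_image[OF inj_on_subset[OF injT subset_UNIV], of B]
    by (simp add: card_Un_disjoint)
  with conf show ?thesis by blast
qed

section \<open>Generic projections of grids\<close>

text \<open>
  One more dimension of the grid. The new lines have a slope \<open>s\<close> that no old line has and that
  separates the points, so the new lines through different points are parallel and distinct.
  The step length \<open>u\<close> of the translations along \<open>s\<close> is chosen such that no translate of a
  point falls on a different translate of a line.
\<close>

lemma slope_config_add_direction:
  assumes conf: "slope_config d k P L"
  shows "\<exists>P' L'. slope_config (Suc d) k P' L' \<and> card P' = k * card P"
proof -
  have fin: "finite P" "finite L"
    using conf by (auto simp: slope_config_def)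
  \<comment> \<open>The slopes of the lines and of all chords between two points. Division by zero adds
    the value \<open>0\<close> to the excluded slopes, which does no harm.\<close>
  define bad where "bad = fst ` L \<union>
    (\<lambda>(p, q). (snd p - snd q) / (fst p - fst q)) ` (P \<times> P)"
  have "finite bad" using fin by (auto simp: bad_def)
  then obtain s where s: "s \<notin> bad"
    using ex_new_if_finite infinite_UNIV_char_0 by metis
  have s_slope: "s \<noteq> fst l" if "l \<in> L" for l
    using s that by (auto simp: bad_def)
  have s_sep: "p = q" if "p \<in> P" "q \<in> P" "snd p - s * fst p = snd q - s * fst q" for p q
  proof (rule ccontr)
    assume "p \<noteq> q"
    then have ne: "fst p - fst q \<noteq> 0" using that(3) by (auto simp: prod_eq_iff)
    have "s * (fst p - fst q) = snd p - snd q"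
      using that(3) by (simp add: algebra_simps)
    then have "s = (snd p - snd q) / (fst p - fst q)"
      using ne by (simp add: eq_divide_eq)
    then show False using s that by (auto simp: bad_def image_iff)
  qed
  define bad' where "bad' = insert 0
    ((\<lambda>(p, l, i, j). (fst l * fst p + snd l - snd p) / ((real i - real j) * (s - fst l))) `
      (P \<times> L \<times> {..<k} \<times> {..<k}))"
  have "finite bad'" using fin by (auto simp: bad'_def)
  then obtain u where u: "u \<notin> bad'"
    using ex_new_if_finite infinite_UNIV_char_0 by metis
  have u0: "u \<noteq> 0" using u by (auto simp: bad'_def)
  define T :: "nat \<Rightarrow> real \<times> real \<Rightarrow> real \<times> real"
    where "T = (\<lambda>i p. (fst p + i * u, snd p + s * (i * u)))"
  define G :: "nat \<Rightarrow> real \<times> real \<Rightarrow> real \<times> real"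
    where "G = (\<lambda>i l. (fst l, snd l + (s - fst l) * (i * u)))"
  define new :: "real \<times> real \<Rightarrow> real \<times> real" where "new = (\<lambda>p. (s, snd p - s * fst p))"
  have same: "incident (T i p) (G i l) \<longleftrightarrow> incident p l" for i p l
    by (auto simp: incident_def T_def G_def algebra_simps)
  have cross: "i = j"
    if "p \<in> P" "l \<in> L" "i < k" "j < k" "incident (T i p) (G j l)" for i j p l
  proof (rule ccontr)
    assume "i \<noteq> j"
    have "u * ((real i - real j) * (s - fst l)) = fst l * fst p + snd l - snd p"
      using that(5) by (simp add: incident_def T_def G_def algebra_simps)
    moreover have "(real i - real j) * (s - fst l) \<noteq> 0"
      using that s_slope \<open>i \<noteq> j\<close> by simp
    ultimately have "u = (fst l * fst p + snd l - snd p) / ((real i - real j) * (s - fst l))"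
      by (simp add: eq_divide_eq)
    then show False
      using u that unfolding bad'_def
      by (metis (mono_tags, lifting) SigmaI case_prod_conv image_eqI insertCI lessThan_iff)
  qed
  have inc_new: "incident (T i p) (new q) \<longleftrightarrow> p = q" if "p \<in> P" "q \<in> P" for i p q
    using s_sep[OF that] by (auto simp: incident_def T_def new_def algebra_simps)
  have T_eq: "T i p = T j q \<longleftrightarrow> i = j \<and> p = q" if "p \<in> P" "q \<in> P" for i j p q
  proof
    assume eq: "T i p = T j q"
    then have "p = q" using inc_new[OF that, of i] inc_new[OF that(2,2), of j] by simp
    then show "i = j \<and> p = q" using eq u0 by (simp add: T_def)
  qed simp
  have injG: "inj (G i)" for i by (auto simp: G_def inj_def prod_eq_iff)
  define P' where "P' = (\<lambda>(i, p). T i p) ` ({..<k} \<times> P)"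
  define L' where "L' = (\<Union>i<k. G i ` L) \<union> new ` P"
  have P'_eq: "P' = (\<Union>i<k. T i ` P)" by (force simp: P'_def)
  have "inj_on (\<lambda>(i, p). T i p) ({..<k} \<times> P)"
    using T_eq by (auto simp: inj_on_def)
  then have cardP': "card P' = k * card P"
    by (simp add: P'_def card_image card_cartesian_product)
  have deg_point: "card {l \<in> L'. incident (T i p) l} = Suc d" if "i < k" "p \<in> P" for i p
  proof -
    have "{l \<in> L'. incident (T i p) l} = insert (new p) (G i ` {l\<in>L. incident p l})"
      using that same cross inc_new unfolding L'_def by blast
    moreover have "new p \<notin> G i ` {l\<in>L. incident p l}"
      using s_slope by (auto simp: new_def G_def)
    moreover have "card (G i ` {l\<in>L. incident p l}) = d"
      using conf that injG[of i]
      by (simp add: slope_config_def card_image[OF inj_on_subset[OF _ subset_UNIV]])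
    ultimately show ?thesis using fin by simp
  qed
  have deg_old: "card {p \<in> P'. incident p (G i l)} = k" if "i < k" "l \<in> L" for i l
  proof -
    have "{p \<in> P'. incident p (G i l)} = T i ` {p\<in>P. incident p l}"
      using that same cross unfolding P'_eq by blast
    moreover have "inj_on (T i) {p\<in>P. incident p l}"
      using T_eq by (auto simp: inj_on_def)
    ultimately show ?thesis
      using conf that by (simp add: slope_config_def card_image)
  qed
  have deg_new: "card {p \<in> P'. incident p (new q)} = k" if "q \<in> P" for q
  proof -
    have "{p \<in> P'. incident p (new q)} = (\<lambda>i. T i q) ` {..<k}"
      using that inc_new unfolding P'_eq by blast
    moreover have "inj_on (\<lambda>i. T i q) {..<k}"
      using T_eq that by (auto simp: inj_on_def)
    ultimately show ?thesis by (simp add: card_image)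
  qed
  have "slope_config (Suc d) k P' L'"
    unfolding slope_config_def
  proof (intro conjI ballI)
    show "finite P'" "finite L'" using fin by (auto simp: P'_def L'_def)
    show "card {l \<in> L'. incident p l} = Suc d" if "p \<in> P'" for p
      using that deg_point by (auto simp: P'_def)
    show "card {p \<in> P'. incident p l} = k" if "l \<in> L'" for l
      using that deg_old deg_new by (auto simp: L'_def)
  qed
  with cardP' show ?thesis by blast
qed

lemma slope_config_grid: "\<exists>P L. slope_config d k P L \<and> card P = k ^ d"
proof (induction d)
  case 0
  have "slope_config 0 k {(0, 0)} {}" by (simp add: slope_config_def)
  then show ?case by (metis card_1_singleton_iff One_nat_def power_0)
next
  case (Suc d)
  then show ?case using slope_config_add_direction by (metis power_Suc)
qed

section \<open>Deleting a point and adding an axis\<close>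

text \<open>
  An axis parallel to no line of the configuration that avoids its points and the
  intersections of its lines can be moved to the horizontal axis by a shear along the vertical
  direction, and such a shear keeps all lines non-vertical. The axis meets the line \<open>l\<close> at
  abscissa \<open>- snd l / fst l\<close>.
\<close>

lemma slope_config_generic_axis:
  assumes conf: "slope_config d k P L"
  shows "\<exists>P' L'. slope_config d k P' L' \<and> card P' = card P \<and>
    (\<forall>p\<in>P'. snd p \<noteq> 0) \<and> (\<forall>l\<in>L'. fst l \<noteq> 0) \<and>
    inj_on (\<lambda>l. - snd l / fst l) L'"
proof -
  have fin: "finite P" "finite L"
    using conf by (auto simp: slope_config_def)
  obtain c where "c \<notin> fst ` L"
    using ex_new_if_finite infinite_UNIV_char_0 fin by (metis finite_imageI)
  then have c: "fst l - c \<noteq> 0" if "l \<in> L" for l using that by auto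
  define bad where "bad = (\<lambda>p. snd p - c * fst p) ` P \<union>
    (\<lambda>(l, m). (snd l * (fst m - c) - snd m * (fst l - c)) / (fst m - fst l)) ` (L \<times> L)"
  have "finite bad" using fin by (auto simp: bad_def)
  then obtain e where e: "e \<notin> bad"
    using ex_new_if_finite infinite_UNIV_char_0 by metis
  define S :: "real \<times> real \<Rightarrow> real \<times> real" where "S = (\<lambda>p. (fst p, snd p - c * fst p - e))"
  define G :: "real \<times> real \<Rightarrow> real \<times> real" where "G = (\<lambda>l. (fst l - c, snd l - e))"
  have injS: "inj S" and injG: "inj G" by (auto simp: S_def G_def inj_def prod_eq_iff)
  have "slope_config d k (S ` P) (G ` L)"
    by (rule slope_config_image[OF conf injS injG])
      (auto simp: S_def G_def incident_def algebra_simps)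
  moreover have "card (S ` P) = card P"
    using injS by (meson card_image inj_on_subset subset_UNIV)
  moreover have "\<forall>p \<in> S ` P. snd p \<noteq> 0"
    using e by (auto simp: S_def bad_def image_iff algebra_simps)
  moreover have "\<forall>l \<in> G ` L. fst l \<noteq> 0"
    using c by (auto simp: G_def)
  moreover have "inj_on (\<lambda>l. - snd l / fst l) (G ` L)"
  proof -
    have "l = m" if lm: "l \<in> L" "m \<in> L"
      and eq: "- (snd l - e) / (fst l - c) = - (snd m - e) / (fst m - c)" for l m
    proof -
      have eq': "(snd l - e) * (fst m - c) = (snd m - e) * (fst l - c)"
        using eq c[OF lm(1)] c[OF lm(2)] by (simp add: field_simps)
      have "fst l = fst m"
      proof (rule ccontr)
        assume "fst l \<noteq> fst m"
        moreover have "e * (fst m - fst l) = snd l * (fst m - c) - snd m * (fst l - c)"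
          using eq' by (simp add: algebra_simps)
        ultimately have "e = (snd l * (fst m - c) - snd m * (fst l - c)) / (fst m - fst l)"
          by (simp add: eq_divide_eq)
        then show False using e lm by (auto simp: bad_def image_iff)
      qed
      then show "l = m" using eq' c[OF lm(1)] by (simp add: prod_eq_iff)
    qed
    then show ?thesis unfolding inj_on_def G_def ball_simps fst_conv snd_conv by metis
  qed
  ultimately show ?thesis by blast
qed

text \<open>The powers of a sufficiently large number will do.\<close>

lemma ratios_avoiding_finite_set:
  fixes R :: "real set"
  assumes "finite R"
  shows "\<exists>t :: nat \<Rightarrow> real. (\<forall>i. t i \<noteq> 0) \<and> (\<forall>i j. i \<noteq> j \<longrightarrow> t i / t j \<notin> R)"
proof -
  define R' where "R' = insert 1 (abs ` (R \<union> inverse ` R))"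
  define M where "M = Max R' + 1"
  have fin: "finite R'" using assms by (simp add: R'_def)
  have M: "r < M" if "r \<in> R'" for r
    using Max_ge[OF fin that] by (simp add: M_def)
  have M1: "M > 1" using M by (simp add: R'_def)
  have pow: "M ^ n \<notin> R \<union> inverse ` R" if "n > 0" for n
  proof
    assume "M ^ n \<in> R \<union> inverse ` R"
    then have "\<bar>M ^ n\<bar> \<in> R'" by (auto simp: R'_def)
    then have "M ^ n < M" using M M1 by fastforce
    moreover have "M ^ 1 \<le> M ^ n" using M1 that by (intro power_increasing) auto
    ultimately show False by simp
  qed
  have "M ^ i / M ^ j \<notin> R" if "i \<noteq> j" for i j
  proof (cases "i > j")
    case True
    then have "M ^ i / M ^ j = M ^ (i - j)" using M1 by (simp add: power_diff)
    then show ?thesis using pow[of "i - j"] True by auto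
  next
    case False
    then have "inverse (M ^ i / M ^ j) = M ^ (j - i)"
      using M1 that by (simp add: power_diff)
    then show ?thesis using pow[of "j - i"] False that by (metis UnI2 image_eqI le_neq_implies_less
        linorder_not_less zero_less_diff)
  qed
  then show ?thesis using M1 by (intro exI[of _ "\<lambda>i. M ^ i"]) auto
qed

text \<open>
  The affinities \<open>(x, y) \<mapsto> (x, t y)\<close> fix the horizontal axis pointwise. An image of a point
  lies on a different image of a line for one ratio of the two factors at most, so suitable
  factors exclude all unwanted incidences.
\<close>

lemma slope_config_switch:
  assumes conf0: "slope_config k k P0 L0" and k: "k > 0" and ne: "P0 \<noteq> {}"
  shows "\<exists>P L. slope_config k k P L \<and> card P = (k - 1) * card P0 + 1"
proof -
  obtain P L where conf: "slope_config k k P L" and card_eq: "card P = card P0"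
    and Py: "\<And>p. p \<in> P \<Longrightarrow> snd p \<noteq> 0" and La: "\<And>l. l \<in> L \<Longrightarrow> fst l \<noteq> 0"
    and meet: "inj_on (\<lambda>l. - snd l / fst l) L"
    using slope_config_generic_axis[OF conf0] by blast
  have fin: "finite P" "finite L"
    using conf by (auto simp: slope_config_def)
  have "card P > 0" using card_eq ne conf0 by (simp add: slope_config_def card_gt_0_iff)
  then obtain p0 where p0: "p0 \<in> P" by (metis card.empty ex_in_conv less_irrefl)
  \<comment> \<open>The ratios of factors at which an image of a point meets a different image of a line;
    the ratio \<open>1\<close> is added to make the factors distinct.\<close>
  define R where "R = insert 1 ((\<lambda>(p, l). (fst l * fst p + snd l) / snd p) ` (P \<times> L))"
  have "finite R" using fin by (simp add: R_def)
  then obtain t :: "nat \<Rightarrow> real" where t0: "\<And>i. t i \<noteq> 0"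
    and tR: "\<And>i j. i \<noteq> j \<Longrightarrow> t i / t j \<notin> R"
    using ratios_avoiding_finite_set by metis
  have t_inj: "t i \<noteq> t j" if "i \<noteq> j" for i j
    using tR[OF that] t0[of j] by (auto simp: R_def)
  define F :: "nat \<Rightarrow> real \<times> real \<Rightarrow> real \<times> real" where "F = (\<lambda>i p. (fst p, t i * snd p))"
  define G :: "nat \<Rightarrow> real \<times> real \<Rightarrow> real \<times> real" where "G = (\<lambda>i l. (t i * fst l, t i * snd l))"
  define A :: "real \<times> real \<Rightarrow> real \<times> real" where "A = (\<lambda>l. (- snd l / fst l, 0))"
  define axis :: "real \<times> real" where "axis = (0, 0)"
  have same: "incident (F i p) (G i l) \<longleftrightarrow> incident p l" for i p l
  proof -
    have "incident (F i p) (G i l) \<longleftrightarrow> t i * snd p = t i * (fst l * fst p + snd l)"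
      by (simp add: incident_def F_def G_def algebra_simps)
    then show ?thesis using t0[of i] by (simp add: incident_def)
  qed
  have cross: "i = j" if "p \<in> P" "l \<in> L" "incident (F i p) (G j l)" for i j p l
  proof (rule ccontr)
    assume "i \<noteq> j"
    have "t i * snd p = t j * (fst l * fst p + snd l)"
      using that(3) by (simp add: incident_def F_def G_def algebra_simps)
    then have "t i / t j = (fst l * fst p + snd l) / snd p"
      using t0[of j] Py[OF that(1)] by (simp add: field_simps)
    then show False using tR[OF \<open>i \<noteq> j\<close>] that by (auto simp: R_def image_iff)
  qed
  have F_G: "incident (F i p) (G j l) \<longleftrightarrow> i = j \<and> incident p l" if "p \<in> P" "l \<in> L" for i j p l
    using cross[OF that] same by metis
  have F_axis: "\<not> incident (F i p) axis" if "p \<in> P" for i p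
    using Py[OF that] t0[of i] by (simp add: incident_def F_def axis_def)
  have A_axis: "incident (A l) axis" for l
    by (simp add: incident_def A_def axis_def)
  have A_G: "incident (A l) (G i m) \<longleftrightarrow> l = m" if "l \<in> L" "m \<in> L" for i l m
  proof -
    have "incident (A l) (G i m) \<longleftrightarrow> t i * (fst m * (- snd l / fst l) + snd m) = 0"
      by (auto simp: incident_def A_def G_def algebra_simps)
    also have "\<dots> \<longleftrightarrow> - snd l / fst l = - snd m / fst m"
      using t0[of i] La[OF that(1)] La[OF that(2)] by (auto simp: field_simps)
    also have "\<dots> \<longleftrightarrow> l = m" using meet that by (auto simp: inj_on_def)
    finally show ?thesis .
  qed
  have A_inj: "inj_on A L" using meet by (auto simp: inj_on_def A_def)
  have G_inj: "inj (G i)" for i using t0[of i] by (auto simp: G_def inj_def prod_eq_iff)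
  have G_ne: "G i l \<noteq> G j l" if "i \<noteq> j" "l \<in> L" for i j l
    using t_inj[OF that(1)] La[OF that(2)] by (simp add: G_def)
  have G_axis: "G i l \<noteq> axis" if "l \<in> L" for i l
    using La[OF that] t0[of i] by (simp add: G_def axis_def)
  have A_F: "F i p \<noteq> A l" if "p \<in> P" for i p l
    using F_axis[OF that] A_axis by metis
  have F_eq: "F i p = F j q \<longleftrightarrow> i = j \<and> p = q" if "p \<in> P" "q \<in> P" for i j p q
  proof
    assume eq: "F i p = F j q"
    have "card {l\<in>L. incident p l} > 0" using conf that k by (simp add: slope_config_def)
    then have "{l\<in>L. incident p l} \<noteq> {}" by (metis card.empty less_irrefl)
    then obtain l where "l \<in> L" "incident p l" by blast
    then have "i = j" using eq same[of i p l] cross[OF that(2), of l j i] by metis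
    then show "i = j \<and> p = q" using eq t0[of j] by (simp add: F_def prod_eq_iff)
  qed simp
  define L0' where "L0' = {l\<in>L. incident p0 l}"
  define Q where "Q = (\<lambda>(i, p). F i p) ` ({..<k - 1} \<times> (P - {p0})) \<union> A ` L0'"
  define M where "M = insert axis (\<Union>i<k - 1. G i ` L)"
  have copies_eq: "(\<lambda>(i, p). F i p) ` ({..<k - 1} \<times> (P - {p0})) = (\<Union>i<k - 1. F i ` (P - {p0}))"
    by force
  have Q_eq: "Q = (\<Union>i<k - 1. F i ` (P - {p0})) \<union> A ` L0'"
    by (simp only: Q_def copies_eq)
  have L0': "L0' \<subseteq> L" "card L0' = k" "finite L0'"
    using conf p0 fin by (auto simp: L0'_def slope_config_def)
  have cardQ: "card Q = (k - 1) * card P0 + 1"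
  proof -
    have "inj_on (\<lambda>(i, p). F i p) ({..<k - 1} \<times> (P - {p0}))"
      using F_eq by (auto simp: inj_on_def)
    moreover have "(\<lambda>(i, p). F i p) ` ({..<k - 1} \<times> (P - {p0})) \<inter> A ` L0' = {}"
      using A_F unfolding copies_eq by blast
    moreover have "card (A ` L0') = k"
      using L0' A_inj by (metis card_image inj_on_subset)
    ultimately have "card Q = (k - 1) * (card P - 1) + k"
      using fin L0' p0 by (simp add: Q_def card_Un_disjoint card_image card_cartesian_product)
    moreover have "(k - 1) * card P = (k - 1) * (card P - 1) + (k - 1)"
      using \<open>card P > 0\<close> by (cases "card P") auto
    ultimately show ?thesis using card_eq k by simp
  qed
  have deg_F: "card {l \<in> M. incident (F i p) l} = k" if "i < k - 1" "p \<in> P" for i p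
  proof -
    have "{l \<in> M. incident (F i p) l} = G i ` {l\<in>L. incident p l}"
      using that F_axis[OF that(2), of i] by (auto simp: M_def F_G)
    then show ?thesis
      using conf that G_inj[of i]
      by (simp add: slope_config_def card_image[OF inj_on_subset[OF _ subset_UNIV]])
  qed
  have deg_A: "card {l \<in> M. incident (A m) l} = k" if "m \<in> L" for m
  proof -
    have "{l \<in> M. incident (A m) l} = insert axis ((\<lambda>i. G i m) ` {..<k - 1})"
      using that A_axis[of m] by (auto simp: M_def A_G)
    moreover have "axis \<notin> (\<lambda>i. G i m) ` {..<k - 1}" using G_axis[OF that] by auto
    moreover have "inj_on (\<lambda>i. G i m) {..<k - 1}"
      using G_ne that by (meson inj_onI)
    ultimately show ?thesis using k by (simp add: card_image)
  qed
  have deg_G: "card {q \<in> Q. incident q (G i l)} = k" if "i < k - 1" "l \<in> L" for i l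
  proof -
    let ?X = "{p\<in>P. incident p l}"
    have X: "card ?X = k" "finite ?X" using conf that fin by (auto simp: slope_config_def)
    have Finj: "inj_on (F i) Y" if "Y \<subseteq> P" for Y
      using F_eq that by (auto simp: inj_on_def subset_iff)
    show ?thesis
    proof (cases "incident p0 l")
      case True
      have "{q \<in> Q. incident q (G i l)} = insert (A l) (F i ` (?X - {p0}))"
        using that True by (auto simp: Q_eq L0'_def F_G A_G)
      moreover have "A l \<notin> F i ` (?X - {p0})"
      proof
        assume "A l \<in> F i ` (?X - {p0})"
        then obtain p where "p \<in> P" "A l = F i p" by blast
        then show False using A_F[of p i l] by simp
      qed
      moreover have "card (F i ` (?X - {p0})) = k - 1"
        using Finj[of "?X - {p0}"] X p0 True by (simp add: card_image subset_iff)
      ultimately show ?thesis using X k by simp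
    next
      case False
      have "{q \<in> Q. incident q (G i l)} = F i ` ?X"
        using that False by (auto simp: Q_eq L0'_def F_G A_G)
      then show ?thesis using Finj[of ?X] X by (simp add: card_image subset_iff)
    qed
  qed
  have deg_axis: "card {q \<in> Q. incident q axis} = k"
  proof -
    have "{q \<in> Q. incident q axis} = A ` L0'"
      by (auto simp: Q_eq F_axis A_axis)
    then show ?thesis using L0' A_inj by (metis card_image inj_on_subset)
  qed
  have "slope_config k k Q M"
    unfolding slope_config_def
  proof (intro conjI ballI)
    show "finite Q" "finite M" using fin L0' by (auto simp: Q_def M_def)
    show "card {l \<in> M. incident q l} = k" if "q \<in> Q" for q
      using that deg_F deg_A L0' by (auto simp: Q_def)
    show "card {q \<in> Q. incident q l} = k" if "l \<in> M" for l
      using that deg_G deg_axis by (auto simp: M_def)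
  qed
  with cardQ show ?thesis by blast
qed

section \<open>All large sizes\<close>

lemma semigroup_contains_all_large:
  fixes S :: "nat set"
  assumes zero: "0 \<in> S" and add: "\<And>a b. a \<in> S \<Longrightarrow> b \<in> S \<Longrightarrow> a + b \<in> S"
    and gens: "m \<in> S" "q * m + 1 \<in> S" and m: "m > 0" and n: "n \<ge> m * (q * m + 1)"
  shows "n \<in> S"
proof -
  have mult: "c * a \<in> S" if "a \<in> S" for a c
    using that by (induction c) (auto intro: zero add)
  \<comment> \<open>The residue of \<open>n\<close> modulo \<open>m\<close> is produced by copies of \<open>q m + 1\<close>, which is \<open>1\<close> modulo \<open>m\<close>.\<close>
  define r where "r = n mod m"
  have "r * (q * m + 1) \<le> m * (q * m + 1)"
    using m by (intro mult_right_mono) (auto simp: r_def less_imp_le)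
  with n have le: "r * (q * m + 1) \<le> n" by linarith
  have "m * (n div m) + r = n" by (simp add: r_def)
  moreover have "r * (q * m + 1) = m * (r * q) + r" by (simp add: algebra_simps)
  ultimately have "n - r * (q * m + 1) = (n div m - r * q) * m"
    by (simp add: diff_mult_distrib algebra_simps)
  with le have "n = (n div m - r * q) * m + r * (q * m + 1)" by linarith
  then show ?thesis using add mult gens by metis
qed

lemma slope_config_eventually_exists:
  assumes "k > 0"
  shows "\<exists>N>0. \<forall>n\<ge>N. \<exists>P L. slope_config k k P L \<and> card P = n"
proof -
  define S where "S = {n. \<exists>P L. slope_config k k P L \<and> card P = n}"
  obtain P L where PL: "slope_config k k P L" "card P = k ^ k"
    using slope_config_grid by blast
  define m where "m = k ^ k"
  have m: "m > 0" using assms by (simp add: m_def)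
  have "slope_config k k {} {}" by (simp add: slope_config_def)
  then have "0 \<in> S" unfolding S_def by (metis (mono_tags, lifting) card.empty mem_Collect_eq)
  moreover have "a + b \<in> S" if "a \<in> S" "b \<in> S" for a b
    using that slope_config_sum unfolding S_def by blast
  moreover have "m \<in> S" using PL by (auto simp: S_def m_def)
  moreover have "(k - 1) * m + 1 \<in> S"
    using slope_config_switch[OF PL(1) assms] PL(2) m unfolding S_def m_def by fastforce
  ultimately have "n \<in> S" if "n \<ge> m * ((k - 1) * m + 1)" for n
    using semigroup_contains_all_large m that by metis
  then show ?thesis
    using m unfolding S_def by (intro exI[of _ "m * ((k - 1) * m + 1)"]) auto
qed

section \<open>Transfer to the Euclidean plane\<close>

definition plane_point :: "real \<times> real \<Rightarrow> real ^ 2" where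
  "plane_point p = vector [fst p, snd p]"

definition plane_line :: "real \<times> real \<Rightarrow> (real ^ 2) set" where
  "plane_line l = {v. v $ 2 = fst l * v $ 1 + snd l}"

lemma plane_point_in_plane_line [simp]: "plane_point p \<in> plane_line l \<longleftrightarrow> incident p l"
  by (simp add: plane_point_def plane_line_def incident_def)

lemma inj_plane_point: "inj plane_point"
  by (rule injI) (metis plane_point_def prod_eq_iff vector_2)

lemma inj_plane_line: "inj plane_line"
proof (rule injI)
  fix l m :: "real \<times> real"
  assume "plane_line l = plane_line m"
  then have "incident p l \<longleftrightarrow> incident p m" for p
    by (metis plane_point_in_plane_line)
  from this[of "(0, snd l)"] this[of "(1, fst l + snd l)"]
  show "l = m" by (simp add: incident_def prod_eq_iff)
qed

lemma is_line_plane_line: "is_line (plane_line l)"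
proof -
  define p where "p = plane_point (0, snd l)"
  define q where "q = plane_point (1, fst l + snd l)"
  have comps: "p $ 1 = 0" "p $ 2 = snd l" "q $ 1 = 1" "q $ 2 = fst l + snd l"
    by (simp_all add: p_def q_def plane_point_def)
  have "plane_line l = affine hull {p, q}"
  proof (rule set_eqI)
    fix v :: "real ^ 2"
    have "v \<in> affine hull {p, q} \<longleftrightarrow> (\<exists>a b. v = a *\<^sub>R p + b *\<^sub>R q \<and> a + b = 1)"
      by (auto simp: affine_hull_2)
    also have "\<dots> \<longleftrightarrow> v = (1 - v $ 1) *\<^sub>R p + (v $ 1) *\<^sub>R q"
    proof
      assume "\<exists>a b. v = a *\<^sub>R p + b *\<^sub>R q \<and> a + b = 1"
      then obtain a b where v: "v = a *\<^sub>R p + b *\<^sub>R q" and ab: "a + b = 1" by blast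
      have "v $ 1 = b" using v comps by simp
      then show "v = (1 - v $ 1) *\<^sub>R p + (v $ 1) *\<^sub>R q" using v ab
        by (metis add_diff_cancel_right')
    next
      assume "v = (1 - v $ 1) *\<^sub>R p + (v $ 1) *\<^sub>R q"
      then show "\<exists>a b. v = a *\<^sub>R p + b *\<^sub>R q \<and> a + b = 1"
        by (metis diff_add_cancel)
    qed
    also have "\<dots> \<longleftrightarrow> v \<in> plane_line l"
      by (auto simp: vec_eq_iff forall_2 comps plane_line_def algebra_simps)
    finally show "v \<in> plane_line l \<longleftrightarrow> v \<in> affine hull {p, q}" by simp
  qed
  moreover have "p \<noteq> q" using comps by auto
  ultimately show ?thesis
    by (simp add: is_line_def affine_affine_hull aff_dim_2)
qed

lemma geometric_configuration_of_slope_config: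
  assumes conf: "slope_config k k P L" and k: "k > 0"
  shows "geometric_configuration (card P) k (plane_point ` P) (plane_line ` L)"
proof -
  have pts: "{p \<in> plane_point ` P. p \<in> plane_line l} = plane_point ` {p\<in>P. incident p l}" for l
    by auto
  have lns: "{l \<in> plane_line ` L. plane_point p \<in> l} = plane_line ` {l\<in>L. incident p l}" for p
    by auto
  have "card (plane_point ` X) = card X" "card (plane_line ` X) = card X" for X
    using inj_plane_point inj_plane_line by (meson card_image inj_on_subset subset_UNIV)+
  then show ?thesis
    using conf slope_config_card_lines[OF conf k] pts lns is_line_plane_line
    unfolding geometric_configuration_def slope_config_def by simp
qed

theorem theorem4:
  fixes k :: nat
  assumes "k \<ge> 2"
  shows "(\<exists>N. is_N k N) \<and>
         (\<exists>N>0. \<forall>n\<ge>N. \<exists>P L. geometric_configuration n k P L)"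
proof
  have k: "k > 0" using assms by simp
  show ex: "\<exists>N>0. \<forall>n\<ge>N. \<exists>P L. geometric_configuration n k P L"
    using slope_config_eventually_exists[OF k] geometric_configuration_of_slope_config[OF _ k]
    by metis
  then have "\<exists>N. config_threshold k N" by (auto simp: config_threshold_def)
  then have "is_N k (LEAST N. config_threshold k N)"
    unfolding is_N_def by (metis LeastI_ex Least_le)
  then show "\<exists>N. is_N k N" ..
qed

end
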